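(* Let $\mathcal{F}$ be a product family of $d\times d$ matrices with uncertainty sets $\mathcal{F}_1,\ldots,\mathcal{F}_d$, and consider the problem of maximizing the spectral radius over $\mathcal{F}$. If all uncertainty sets are strictly positive, then the rate of convergence of both the greedy method and the spectral simplex method is at least linear with a factor $q$ satisfying $$q\ \le\ 1-\frac{m^2}{m^2+(d-1)M^2},$$ where $m$ and $M$ are respectively the smallest and the biggest entries of vectors from the uncertainty sets.
   Context: Product family: for non-empty compact sets (uncertainty sets) $\mathcal{F}_i\subset\mathbb{R}^d_+$, $\mathcal{F}$ is the set of all $d\times d$ matrices whose $i$th row belongs to $\mathcal{F}_i$, $i=1,\ldots,d$. An uncertainty set is strictly positive if all its vectors have only positive entries. $\rho(A)$ is the spectral radius, and a leading eigenvector of a non-negative matrix is a non-zero non-negative eigenvector for the eigenvalue $\rho(A)$. Both methods start with an arbitrary $A_1\in\mathcal{F}$ and produce matrices $A_1,A_2,\ldots\in\mathcal{F}$. In the $k$th iteration one takes a leading eigenvector $\boldsymbol{v}_k=(v_{k,1},\ldots,v_{k,d})$ of $A_k$, whose rows are $\boldsymbol{a}_i^{(k)}$. A row $\boldsymbol{a}_i^{(k)}$ is optimal if $(\boldsymbol{a}_i^{(k)},\boldsymbol{v}_k)=\max_{\boldsymbol{a}\in\mathcal{F}_i}(\boldsymbol{a},\boldsymbol{v}_k)$. If all rows are optimal, the method terminates. Greedy method: $A_{k+1}$ is obtained from $A_k$ by replacing every non-optimal row $\boldsymbol{a}_i^{(k)}$ by a maximizer of $(\boldsymbol{a},\boldsymbol{v}_k)$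 over $\boldsymbol{a}\in\mathcal{F}_i$; optimal rows are kept. Spectral simplex method: the rows are checked in the order $i=1,2,\ldots,d$; the first non-optimal row found is replaced by a maximizer of $(\boldsymbol{a},\boldsymbol{v}_k)$ over $\boldsymbol{a}\in\mathcal{F}_i$, all other rows are kept, and this gives $A_{k+1}$. (In the variant with the pivoting rule, one instead replaces the row for which $\max_{\boldsymbol{b}\in\mathcal{F}_i}(\boldsymbol{b},\boldsymbol{v}_k)/v_{k,i}$ is maximal over $i$.) Linear rate with factor $q$: with $\rho_k=\rho(A_k)$ and $\rho_{\max}=\max_{A\in\mathcal{F}}\rho(A)$, one has $\rho_{\max}-\rho_{k+1}\le q^{k}(\rho_{\max}-\rho_1)$ in each iteration $k$.
   Formalization: The spectral simplex method is taken in its variant with the pivoting rule (ties broken arbitrarily); for the rule replacing the first non-optimal row the stated rate is false, e.g. d=2, sets {(1,1),(1.1,1)} and {(1,1),(2,2)}, starting from the all-ones matrix. *)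

theory Defs
  imports "HOL-Analysis.Analysis"
begin

definition uncertainty_set :: "(real ^ 'n) set \<Rightarrow> bool" where
  "uncertainty_set S \<longleftrightarrow> S \<noteq> {} \<and> compact S \<and> (\<forall>x\<in>S. \<forall>j. 0 \<le> x $ j)"

definition strictly_positive :: "(real ^ 'n) set \<Rightarrow> bool" where
  "strictly_positive S \<longleftrightarrow> (\<forall>x\<in>S. \<forall>j. 0 < x $ j)"

(* A $ i is the i-th row of A. *)
definition product_family :: "('n \<Rightarrow> (real ^ 'n) set) \<Rightarrow> (real ^ 'n ^ 'n) set" where
  "product_family F = {A. \<forall>i. A $ i \<in> F i}"

definition entries :: "('n \<Rightarrow> (real ^ 'n) set) \<Rightarrow> real set" where
  "entries F = {x $ j | x i j. x \<in> F i}"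

(* For non-empty compact F i, the infimum and the supremum are attained. *)
definition smallest_entry :: "('n \<Rightarrow> (real ^ 'n) set) \<Rightarrow> real" where
  "smallest_entry F = Inf (entries F)"

definition biggest_entry :: "('n \<Rightarrow> (real ^ 'n) set) \<Rightarrow> real" where
  "biggest_entry F = Sup (entries F)"

definition complex_eigenvalues :: "real ^ 'n ^ 'n \<Rightarrow> complex set" where
  "complex_eigenvalues A =
     {c. \<exists>z :: complex ^ 'n. z \<noteq> 0 \<and> (\<chi> i j. complex_of_real (A $ i $ j)) *v z = c *s z}"

(* The set of eigenvalues is finite and non-empty, so Max is meaningful. *)
definition spec_radius :: "real ^ 'n ^ 'n \<Rightarrow> real" where
  "spec_radius A = Max (cmod ` complex_eigenvalues A)"

(* For non-empty compact F i the supremum is attained, by continuity of the spectral radius. *)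
definition max_spec_radius :: "('n \<Rightarrow> (real ^ 'n) set) \<Rightarrow> real" where
  "max_spec_radius F = Sup (spec_radius ` product_family F)"

definition leading_eigenvector :: "real ^ 'n ^ 'n \<Rightarrow> real ^ 'n \<Rightarrow> bool" where
  "leading_eigenvector A v \<longleftrightarrow>
     v \<noteq> 0 \<and> (\<forall>i. 0 \<le> v $ i) \<and> A *v v = spec_radius A *s v"

definition is_maximizer :: "(real ^ 'n) set \<Rightarrow> real ^ 'n \<Rightarrow> real ^ 'n \<Rightarrow> bool" where
  "is_maximizer S v a \<longleftrightarrow> a \<in> S \<and> (\<forall>b\<in>S. b \<bullet> v \<le> a \<bullet> v)"

(* A row of a matrix from the family is optimal iff it is a maximizer over its uncertainty set. *)
definition greedy_step ::
  "('n \<Rightarrow> (real ^ 'n) set) \<Rightarrow> real ^ 'n \<Rightarrow> real ^ 'n ^ 'n \<Rightarrow> real ^ 'n ^ 'n \<Rightarrow> bool" where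
  "greedy_step F v A B \<longleftrightarrow>
     (\<forall>i. if is_maximizer (F i) v (A $ i) then B $ i = A $ i else is_maximizer (F i) v (B $ i))"

(* The supremum is attained for non-empty compact F i; for strictly positive families
   the denominator is positive, since v is a leading eigenvector of a positive matrix. *)
definition pivot_ratio :: "('n \<Rightarrow> (real ^ 'n) set) \<Rightarrow> real ^ 'n \<Rightarrow> 'n \<Rightarrow> real" where
  "pivot_ratio F v i = (SUP b\<in>F i. b \<bullet> v) / v $ i"

(* Spectral simplex method with the pivoting rule; ties in the choice of the row and of the
   maximizer may be broken arbitrarily. With the rule that takes the first non-optimal row
   there is no such rate: for d = 2 with uncertainty sets {(1,1), (1.1,1)} and {(1,1), (2,2)},
   starting from the all-ones matrix, the first step gains too little. *)
definition spectral_simplex_step ::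
  "('n \<Rightarrow> (real ^ 'n) set) \<Rightarrow> real ^ 'n \<Rightarrow> real ^ 'n ^ 'n \<Rightarrow> real ^ 'n ^ 'n \<Rightarrow> bool" where
  "spectral_simplex_step F v A B \<longleftrightarrow>
     (if \<forall>i. is_maximizer (F i) v (A $ i) then B = A
      else \<exists>i. (\<forall>j. pivot_ratio F v j \<le> pivot_ratio F v i) \<and>
               is_maximizer (F i) v (B $ i) \<and> (\<forall>j. j \<noteq> i \<longrightarrow> B $ j = A $ j))"

(* Runs are indexed from 1. Termination is encoded by repetition: once all rows are optimal,
   both step relations force A (k + 1) = A k. *)
definition method_run ::
  "(('n \<Rightarrow> (real ^ 'n) set) \<Rightarrow> real ^ 'n \<Rightarrow> real ^ 'n ^ 'n \<Rightarrow> real ^ 'n ^ 'n \<Rightarrow> bool) \<Rightarrow>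
   ('n \<Rightarrow> (real ^ 'n) set) \<Rightarrow> (nat \<Rightarrow> real ^ 'n ^ 'n) \<Rightarrow> (nat \<Rightarrow> real ^ 'n) \<Rightarrow> bool" where
  "method_run step F A v \<longleftrightarrow>
     A 1 \<in> product_family F \<and>
     (\<forall>k\<ge>1. leading_eigenvector (A k) (v k) \<and> step F (v k) (A k) (A (k + 1)))"

definition linear_rate ::
  "('n \<Rightarrow> (real ^ 'n) set) \<Rightarrow> (nat \<Rightarrow> real ^ 'n ^ 'n) \<Rightarrow> real \<Rightarrow> bool" where
  "linear_rate F A q \<longleftrightarrow>
     (\<forall>k\<ge>1. max_spec_radius F - spec_radius (A (k + 1))
             \<le> q ^ k * (max_spec_radius F - spec_radius (A 1)))"

end

theory Submission
  imports Defs
begin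

text \<open>
  Let \<open>A\<close> be the current matrix, \<open>v\<close> its leading eigenvector, \<open>\<rho>\<close> its spectral radius and
  \<open>r\<close> the largest pivot ratio, attained at row \<open>i\<close>. Every matrix \<open>C\<close> of the family satisfies
  \<open>C v \<le> r v\<close>, so the Collatz-Wielandt bound (\<open>spec_radius_le\<close>) shows that the optimal
  spectral radius is at most \<open>r\<close>: the gap to the optimum is at most \<open>r - \<rho>\<close>.

  In both methods the next matrix \<open>B\<close> has a maximizer in row \<open>i\<close> and no row of \<open>B\<close> does
  worse on \<open>v\<close> than the same row of \<open>A\<close>; hence \<open>B v \<ge> \<rho> v + (r - \<rho>) v\<^sub>i e\<^sub>i\<close>, where \<open>e\<^sub>i\<close> is the
  unit vector. Pairing this with a positive left Perron vector \<open>u\<close> of \<open>B\<close> gives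
  \<open>\<rho>(B) - \<rho> \<ge> (r - \<rho>) u\<^sub>i v\<^sub>i / (u, v)\<close>. The components of a Perron vector of a matrix with
  entries in \<open>[m, M]\<close> differ by a factor of at most \<open>M / m\<close> (\<open>positive_eigenvector_ratio\<close>).
  Applied to \<open>u\<close> and to \<open>v\<close>, this bounds each of the \<open>d - 1\<close> terms \<open>u\<^sub>j v\<^sub>j\<close> with \<open>j \<noteq> i\<close> by
  \<open>(M / m)\<^sup>2 u\<^sub>i v\<^sub>i\<close>, so that \<open>u\<^sub>i v\<^sub>i / (u, v) \<ge> m\<^sup>2 / (m\<^sup>2 + (d - 1) M\<^sup>2)\<close> (\<open>spec_radius_gain\<close>).
  This fraction of the gap is gained in every iteration.

  The left Perron vector comes from Brouwer's fixed point theorem on the standard simplex.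
  Its eigenvalue is the spectral radius because it pairs to a positive number with the leading
  right eigenvector that the run supplies for \<open>B\<close>.
\<close>

section \<open>The spectrum is finite\<close>

text \<open>
  Eigenvectors for distinct eigenvalues are independent, by the usual elimination: applying
  \<open>A - k\<close> to a vanishing combination removes the term for \<open>k\<close> and multiplies each of the
  other coefficients by the non-zero number \<open>c - k\<close>.
\<close>

lemma eigenvector_combination_zero:
  fixes A :: "'a::field ^ 'n ^ 'n"
  assumes "finite K"
    and "\<And>c. c \<in> K \<Longrightarrow> e c \<noteq> 0 \<and> A *v e c = c *s e c"
    and "(\<Sum>c\<in>K. a c *s e c) = 0"
  shows "\<forall>c\<in>K. a c = 0"
  using assms
proof (induction K arbitrary: a rule: finite_induct)
  case empty
  then show ?case by simp
next
  case (insert k K)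
  let ?s = "\<Sum>c\<in>insert k K. a c *s e c"
  have term_eq: "A *v (a c *s e c) - k *s (a c *s e c) = (a c * (c - k)) *s e c"
    if "c \<in> insert k K" for c
  proof -
    have "A *v (a c *s e c) = a c *s (c *s e c)"
      using insert.prems(1)[OF that] vec.scale[of A "a c" "e c"] by simp
    then show ?thesis
      by (simp add: vec_eq_iff algebra_simps)
  qed
  have "A *v ?s - k *s ?s
      = (\<Sum>c\<in>insert k K. A *v (a c *s e c)) - (\<Sum>c\<in>insert k K. k *s (a c *s e c))"
    by (rule arg_cong2[where f = minus, OF vec.sum vec.scale_sum_right])
  also have "\<dots> = (\<Sum>c\<in>insert k K. A *v (a c *s e c) - k *s (a c *s e c))"
    by (rule sum_subtractf[symmetric])
  also have "\<dots> = (\<Sum>c\<in>insert k K. (a c * (c - k)) *s e c)"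
    by (rule sum.cong[OF refl term_eq])
  also have "\<dots> = (\<Sum>c\<in>K. (a c * (c - k)) *s e c)"
    using insert.hyps by simp
  finally have "(\<Sum>c\<in>K. (a c * (c - k)) *s e c) = 0"
    unfolding insert.prems(2) by simp
  then have "\<forall>c\<in>K. a c * (c - k) = 0"
    by (rule insert.IH[rotated]) (rule insert.prems(1), rule insertI2)
  with insert.hyps have K: "\<forall>c\<in>K. a c = 0"
    by auto
  have "a k *s e k + (\<Sum>c\<in>K. a c *s e c) = 0"
    using insert.prems(2) unfolding sum.insert[OF insert.hyps(1,2)] .
  moreover have "(\<Sum>c\<in>K. a c *s e c) = 0"
    using K by (intro sum.neutral) simp
  ultimately have "a k *s e k = 0"
    by simp
  moreover have "e k \<noteq> 0"
    using insert.prems(1)[of k] by blast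
  ultimately have "a k = 0"
    by simp
  with K show ?case by simp
qed

lemma finite_eigenvalues:
  fixes A :: "'a::field ^ 'n ^ 'n"
  shows "finite {c. \<exists>z. z \<noteq> 0 \<and> A *v z = c *s z}"
proof -
  define C where "C = {c. \<exists>z. z \<noteq> 0 \<and> A *v z = c *s z}"
  define e where "e c = (SOME z. z \<noteq> 0 \<and> A *v z = c *s z)" for c
  have e: "e c \<noteq> 0 \<and> A *v e c = c *s e c" if "c \<in> C" for c
    using that unfolding e_def C_def mem_Collect_eq by (rule someI_ex)
  have inj: "inj_on e C"
  proof (rule inj_onI)
    fix c d assume c: "c \<in> C" "d \<in> C" "e c = e d"
    have "c *s e c = A *v e c"
      by (rule conjunct2[OF e[OF c(1)], symmetric])
    also have "\<dots> = d *s e c"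
      unfolding c(3) by (rule conjunct2[OF e[OF c(2)]])
    finally show "c = d"
      using conjunct1[OF e[OF c(1)]] by (simp only: vec.scale_right_imp_eq)
  qed
  have "vec.independent (e ` C)"
    unfolding vec.dependent_explicit
  proof (intro notI, elim exE conjE bexE)
    fix t u v
    assume t: "finite t" "t \<subseteq> e ` C" "(\<Sum>v\<in>t. u v *s v) = 0" "v \<in> t" "u v \<noteq> 0"
    obtain K where K: "K \<subseteq> C" "finite K" "t = e ` K"
      using finite_subset_image[OF t(1,2)] by blast
    have "(\<Sum>c\<in>K. u (e c) *s e c) = 0"
      using t(3) unfolding K(3) sum.reindex[OF inj_on_subset[OF inj K(1)]] o_def .
    then have "\<forall>c\<in>K. u (e c) = 0"
      by (rule eigenvector_combination_zero[OF K(2), rotated]) (rule e, rule subsetD[OF K(1)])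
    then show False
      using t(4,5) unfolding K(3) by blast
  qed
  then have "finite (e ` C)"
    by (rule vec.finiteI_independent)
  then have "finite C"
    by (rule finite_imageD[OF _ inj])
  then show ?thesis
    unfolding C_def .
qed

text \<open>
  The spectral radius is a \<^const>\<open>Max\<close>, which says nothing about an infinite set. To bound it from
  above by bounding each eigenvalue, the spectrum has to be known to be finite and non-empty.
\<close>

lemma finite_complex_eigenvalues: "finite (complex_eigenvalues A)"
  unfolding complex_eigenvalues_def by (rule finite_eigenvalues)

section \<open>Perron vectors of positive matrices\<close>

lemma positive_matrix_vector_pos:
  fixes A :: "real ^ 'n ^ 'n"
  assumes A: "\<And>i j. 0 < A $ i $ j" and x: "x \<noteq> 0" "\<And>i. 0 \<le> x $ i"
  shows "0 < (A *v x) $ i"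
proof -
  obtain k where "x $ k \<noteq> 0"
    using x(1) by (auto simp: vec_eq_iff)
  then have "0 < x $ k"
    using x(2)[of k] by simp
  then have "0 < A $ i $ k * x $ k"
    using A by simp
  then have "0 < (\<Sum>j\<in>UNIV. A $ i $ j * x $ j)"
    by (intro sum_pos2[of _ k]) (auto simp: x A less_imp_le)
  then show ?thesis
    by (simp add: matrix_vector_mult_def)
qed

lemma nonneg_eigenvector_pos:
  fixes A :: "real ^ 'n ^ 'n"
  assumes A: "\<And>i j. 0 < A $ i $ j" and x: "x \<noteq> 0" "\<And>i. 0 \<le> x $ i"
    and eig: "A *v x = l *s x"
  shows "0 < l" "0 < x $ i"
proof -
  have p: "0 < l * x $ i" for i
    using positive_matrix_vector_pos[OF A x, of i] eig by simp
  show "0 < l" "0 < x $ i"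
    using p[of i] x(2)[of i] by (auto simp: zero_less_mult_iff)
qed

text \<open>
  Normalising \<open>A x\<close> to coordinate sum 1 maps the standard simplex continuously into itself, and
  a fixed point of this map is an eigenvector. Positivity of \<open>A\<close> keeps the normalising sum away
  from zero.
\<close>

lemma perron_vector_exists:
  fixes A :: "real ^ 'n ^ 'n"
  assumes A: "\<And>i j. 0 < A $ i $ j"
  obtains l x where "x \<noteq> 0" "\<And>i. 0 \<le> x $ i" "A *v x = l *s x"
proof -
  define S where "S = {x :: real ^ 'n. (\<forall>i. 0 \<le> x $ i) \<and> (\<Sum>i\<in>UNIV. x $ i) = 1}"
  define s where "s x = (\<Sum>i\<in>UNIV. (A *v x) $ i)" for x
  define f where "f x = inverse (s x) *s (A *v x)" for x
  have S0: "x \<noteq> 0" if "x \<in> S" for x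
    using that by (auto simp: S_def)
  have Apos: "0 < (A *v x) $ i" if "x \<in> S" for x i
    using that S0[OF that] by (intro positive_matrix_vector_pos A) (auto simp: S_def)
  have spos: "0 < s x" if "x \<in> S" for x
    unfolding s_def using Apos[OF that] by (intro sum_pos) auto
  have "S \<subseteq> cbox 0 1"
  proof
    fix x assume x: "x \<in> S"
    have "x $ i \<le> 1" for i
      using member_le_sum[of i UNIV "\<lambda>i. x $ i"] x by (auto simp: S_def)
    then show "x \<in> cbox 0 1"
      using x by (auto simp: S_def mem_box_cart)
  qed
  then have "bounded S"
    using bounded_cbox bounded_subset by blast
  moreover have "closed S"
    unfolding S_def by (intro closed_Collect_conj closed_Collect_all closed_Collect_le
        closed_Collect_eq continuous_intros)
  ultimately have "compact S"
    by (simp add: compact_eq_bounded_closed)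
  moreover have "convex S"
    unfolding convex_def
    by (auto simp: S_def sum.distrib sum_distrib_left[symmetric])
  moreover have "S \<noteq> {}"
  proof -
    have "axis undefined 1 \<in> S"
      by (simp add: S_def axis_def)
    then show ?thesis by auto
  qed
  moreover have "continuous_on S f"
  proof -
    have "continuous_on S (\<lambda>x. A *v x)"
      by (rule linear_continuous_on) (simp add: linear_linear)
    then show ?thesis
      unfolding f_def s_def scalar_mult_eq_scaleR using spos
      by (intro continuous_intros) (auto simp: s_def, fastforce)
  qed
  moreover have "f \<in> S \<rightarrow> S"
  proof
    fix x assume x: "x \<in> S"
    show "f x \<in> S"
      using spos[OF x] Apos[OF x]
      by (auto simp: S_def f_def less_imp_le sum_distrib_left[symmetric] s_def[symmetric])
  qed
  ultimately obtain x where x: "x \<in> S" "f x = x"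
    by (rule brouwer)
  have "A *v x = s x *s x"
  proof -
    have "s x *s x = s x *s f x"
      using x by simp
    also have "\<dots> = A *v x"
      using spos[OF x(1)] by (simp add: f_def vec_eq_iff)
    finally show ?thesis ..
  qed
  then show ?thesis
    using that[of x "s x"] S0[OF x(1)] x(1) by (auto simp: S_def)
qed

text \<open>
  Each component of \<open>l x = A x\<close> is a sum of the coordinates of \<open>x\<close> weighted by a row of \<open>A\<close>, so
  it lies between \<open>m\<close> and \<open>M\<close> times the same coordinate sum.
\<close>

lemma positive_eigenvector_ratio:
  fixes A :: "real ^ 'n ^ 'n"
  assumes A: "\<And>i j. m \<le> A $ i $ j" "\<And>i j. A $ i $ j \<le> M" and m: "0 < m"
    and x: "\<And>i. 0 < x $ i" and eig: "A *v x = l *s x"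
  shows "m * x $ j \<le> M * x $ i"
proof -
  let ?t = "\<Sum>k\<in>UNIV. x $ k"
  have eq: "l * x $ i = (\<Sum>k\<in>UNIV. A $ i $ k * x $ k)" for i
    using arg_cong[OF eig, of "\<lambda>y. y $ i"] by (simp add: matrix_vector_mult_def)
  have up: "l * x $ i \<le> M * ?t" for i
    unfolding eq sum_distrib_left
    by (intro sum_mono mult_right_mono A less_imp_le x)
  have lo: "m * ?t \<le> l * x $ i" for i
    unfolding eq sum_distrib_left
    by (intro sum_mono mult_right_mono A less_imp_le x)
  have t: "0 < ?t"
    using x by (intro sum_pos) auto
  have "0 < m * ?t"
    using t m by simp
  then have "0 < l * x $ i"
    using lo[of i] by linarith
  then have l: "0 < l"
    using x[of i] by (simp add: zero_less_mult_iff)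
  have M: "0 < M"
    using m A[of i i] by linarith
  have "l * (m * x $ j) = m * (l * x $ j)"
    by simp
  also have "\<dots> \<le> m * (M * ?t)"
    using up[of j] m by simp
  also have "\<dots> = M * (m * ?t)"
    by simp
  also have "\<dots> \<le> M * (l * x $ i)"
    using lo[of i] M by simp
  also have "\<dots> = l * (M * x $ i)"
    by simp
  finally show ?thesis
    using l by simp
qed

section \<open>Bounds on the spectral radius\<close>

lemma complex_eigenvalues_nonempty:
  fixes A :: "real ^ 'n ^ 'n"
  assumes A: "\<And>i j. 0 < A $ i $ j"
  shows "complex_eigenvalues A \<noteq> {}"
proof -
  obtain l x where x: "x \<noteq> 0" "A *v x = l *s x"
    using perron_vector_exists[OF A] by metis
  define z where "z = (\<chi> i. complex_of_real (x $ i))"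
  have "z \<noteq> 0"
    using x(1) by (auto simp: z_def vec_eq_iff)
  moreover have "(\<chi> i j. complex_of_real (A $ i $ j)) *v z = complex_of_real l *s z"
    using x(2) by (auto simp: z_def vec_eq_iff matrix_vector_mult_def simp flip: of_real_mult of_real_sum)
  ultimately show ?thesis
    unfolding complex_eigenvalues_def by blast
qed

text \<open>
  The upper Collatz-Wielandt bound. For a complex eigenvector \<open>z\<close>, compare \<open>\<bar>z\<bar>\<close> with \<open>v\<close> at a
  coordinate \<open>i\<close> where the quotient \<open>\<bar>z\<^sub>i\<bar> / v\<^sub>i\<close> is largest: there the triangle inequality turns
  \<open>c z\<^sub>i = (A z)\<^sub>i\<close> into \<open>\<bar>c\<bar> \<le> (A v)\<^sub>i / v\<^sub>i\<close>.
\<close>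

lemma spec_radius_le:
  fixes A :: "real ^ 'n ^ 'n"
  assumes A: "\<And>i j. 0 < A $ i $ j" and v: "\<And>i. 0 < v $ i"
    and le: "\<And>i. (A *v v) $ i \<le> r * v $ i"
  shows "spec_radius A \<le> r"
proof -
  have "cmod c \<le> r" if c: "c \<in> complex_eigenvalues A" for c
  proof -
    obtain z where z: "z \<noteq> 0" "(\<chi> i j. complex_of_real (A $ i $ j)) *v z = c *s z"
      using c unfolding complex_eigenvalues_def by blast
    define g where "g i = cmod (z $ i) / v $ i" for i
    obtain i where i: "\<And>j. g j \<le> g i"
      using Max_in[of "range g"] Max_ge[of "range g"] by fastforce
    obtain k where "z $ k \<noteq> 0"
      using z(1) by (auto simp: vec_eq_iff)
    then have "0 < g k"
      using v by (simp add: g_def)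
    then have gi: "0 < g i"
      using i[of k] by linarith
    have zle: "cmod (z $ j) \<le> g i * v $ j" for j
      using i[of j] v[of j] by (simp add: g_def[of j] divide_simps mult.commute)
    have "cmod c * (g i * v $ i) = cmod (c * z $ i)"
      using v[of i] by (simp add: g_def norm_mult)
    also have "c * z $ i = (\<Sum>j\<in>UNIV. complex_of_real (A $ i $ j) * z $ j)"
      using arg_cong[OF z(2), of "\<lambda>y. y $ i"] by (simp add: matrix_vector_mult_def)
    also have "cmod \<dots> \<le> (\<Sum>j\<in>UNIV. cmod (complex_of_real (A $ i $ j) * z $ j))"
      by (rule norm_sum)
    also have "\<dots> = (\<Sum>j\<in>UNIV. A $ i $ j * cmod (z $ j))"
      using A by (simp add: norm_mult less_imp_le)
    also have "\<dots> \<le> (\<Sum>j\<in>UNIV. A $ i $ j * (g i * v $ j))"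
      by (intro sum_mono mult_left_mono zle less_imp_le A)
    also have "\<dots> = g i * (A *v v) $ i"
      by (simp add: matrix_vector_mult_def sum_distrib_left mult_ac)
    also have "\<dots> \<le> g i * (r * v $ i)"
      using le[of i] gi by simp
    finally have "(g i * v $ i) * cmod c \<le> (g i * v $ i) * r"
      by (simp add: mult_ac)
    then show ?thesis
      using gi v[of i] by simp
  qed
  then show ?thesis
    unfolding spec_radius_def
    using finite_complex_eigenvalues complex_eigenvalues_nonempty[OF A] by (subst Max_le_iff) auto
qed

lemma leading_eigenvector_pos:
  assumes "\<And>i j. 0 < A $ i $ j" "leading_eigenvector A v"
  shows "0 < v $ i"
  using nonneg_eigenvector_pos(2)[of A v "spec_radius A" i] assms
  unfolding leading_eigenvector_def by blast

text \<open>
  A positive left eigenvector for \<open>l\<close> and a positive right eigenvector for \<open>\<rho>\<close> have a positive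
  inner product, and moving \<open>B\<close> from one side of it to the other shows \<open>l = \<rho>\<close>.
\<close>

lemma left_perron_vector_exists:
  fixes B :: "real ^ 'n ^ 'n"
  assumes B: "\<And>i j. 0 < B $ i $ j" and w: "leading_eigenvector B w"
  obtains u where "\<And>i. 0 < u $ i" "transpose B *v u = spec_radius B *s u"
proof -
  have BT: "0 < transpose B $ i $ j" for i j
    using B by (simp add: transpose_def)
  obtain l u where u: "u \<noteq> 0" "\<And>i. 0 \<le> u $ i" "transpose B *v u = l *s u"
    using perron_vector_exists[OF BT] by metis
  have upos: "0 < u $ i" for i
    using nonneg_eigenvector_pos(2)[OF BT u] .
  have wpos: "0 < w $ i" for i
    using leading_eigenvector_pos[OF B w] .
  have "0 < u \<bullet> w"
    unfolding inner_vec_def using upos wpos by (intro sum_pos) auto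
  moreover have "l * (u \<bullet> w) = spec_radius B * (u \<bullet> w)"
  proof -
    have "l * (u \<bullet> w) = (transpose B *v u) \<bullet> w"
      using u(3) by (simp add: scalar_mult_eq_scaleR)
    also have "\<dots> = u \<bullet> (B *v w)"
      by (simp add: dot_lmul_matrix)
    also have "\<dots> = spec_radius B * (u \<bullet> w)"
      using w by (simp add: leading_eigenvector_def scalar_mult_eq_scaleR)
    finally show ?thesis .
  qed
  ultimately have "l = spec_radius B"
    by simp
  with upos u(3) that show ?thesis
    by blast
qed

text \<open>
  The quantitative step. The left Perron vector \<open>u\<close> of \<open>B\<close> turns the componentwise inequalities
  for \<open>B v\<close> into an inequality between numbers, in which the surplus \<open>(r - \<rho>) v\<^sub>i\<close> of row \<open>i\<close>
  enters with the relative weight \<open>u\<^sub>i v\<^sub>i / (u, v)\<close>.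
\<close>

lemma spec_radius_gain:
  fixes B :: "real ^ 'n ^ 'n"
  assumes B: "\<And>i j. m \<le> B $ i $ j" "\<And>i j. B $ i $ j \<le> M" and m: "0 < m"
    and w: "leading_eigenvector B w"
    and v: "\<And>j. 0 < v $ j" "\<And>j. m * v $ j \<le> M * v $ i"
    and lower: "\<And>j. \<rho> * v $ j \<le> (B *v v) $ j"
    and row: "r * v $ i \<le> (B *v v) $ i" and r: "\<rho> \<le> r"
  shows "m\<^sup>2 / (m\<^sup>2 + (real CARD('n) - 1) * M\<^sup>2) * (r - \<rho>) \<le> spec_radius B - \<rho>"
proof -
  have Bpos: "0 < B $ i $ j" for i j
    using B(1)[of i j] m by linarith
  obtain u where u: "\<And>i. 0 < u $ i" "transpose B *v u = spec_radius B *s u"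
    using left_perron_vector_exists[OF Bpos w] by blast
  have M: "0 < M"
    using m B[of i i] by linarith
  have ratio_u: "m * u $ j \<le> M * u $ i" for j
    using B by (intro positive_eigenvector_ratio[OF _ _ m u]) (auto simp: transpose_def)
  have uv: "0 < u \<bullet> v"
    unfolding inner_vec_def using u v by (intro sum_pos) auto
  let ?D = "m\<^sup>2 + (real CARD('n) - 1) * M\<^sup>2"
  have D: "0 < ?D"
    using m by (intro add_pos_nonneg) (auto simp: Suc_le_eq)
  \<comment> \<open>Row \<open>i\<close> carries at least the share \<open>m\<^sup>2 / ?D\<close> of the inner product of \<open>u\<close> and \<open>v\<close>.\<close>
  have weight: "m\<^sup>2 * (u \<bullet> v) \<le> ?D * (u $ i * v $ i)"
  proof -
    have "m\<^sup>2 * (u $ j * v $ j) \<le> M\<^sup>2 * (u $ i * v $ i)" for j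
    proof -
      have "(m * u $ j) * (m * v $ j) \<le> (M * u $ i) * (M * v $ i)"
        by (rule mult_mono[OF ratio_u v(2)])
          (use v(1) u(1) m M in \<open>simp_all add: less_imp_le\<close>)
      then show ?thesis
        by (simp add: power2_eq_square mult_ac)
    qed
    then have "(\<Sum>j\<in>UNIV-{i}. m\<^sup>2 * (u $ j * v $ j)) \<le> (\<Sum>j\<in>UNIV-{i}. M\<^sup>2 * (u $ i * v $ i))"
      by (intro sum_mono)
    also have "\<dots> = (real CARD('n) - 1) * M\<^sup>2 * (u $ i * v $ i)"
      by (simp add: card_Diff_singleton of_nat_diff Suc_le_eq)
    finally show ?thesis
      by (simp add: inner_vec_def sum_distrib_left sum.remove[of UNIV i] algebra_simps)
  qed
  have "\<rho> * (u \<bullet> v) + (r - \<rho>) * (u $ i * v $ i)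
      = (\<Sum>j\<in>UNIV. u $ j * (\<rho> * v $ j + (if j = i then (r - \<rho>) * v $ i else 0)))"
    by (simp add: inner_vec_def sum_distrib_left sum.distrib algebra_simps if_distrib[of "(*) _"]
        cong: if_cong)
  also have "\<dots> \<le> (\<Sum>j\<in>UNIV. u $ j * (B *v v) $ j)"
    using lower row u(1) by (intro sum_mono mult_left_mono) (auto simp: algebra_simps less_imp_le)
  also have "\<dots> = u \<bullet> (B *v v)"
    by (simp add: inner_vec_def)
  also have "\<dots> = (transpose B *v u) \<bullet> v"
    by (simp add: dot_lmul_matrix)
  also have "\<dots> = spec_radius B * (u \<bullet> v)"
    using u(2) by (simp add: scalar_mult_eq_scaleR)
  finally have "(r - \<rho>) * (u $ i * v $ i) \<le> (spec_radius B - \<rho>) * (u \<bullet> v)"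
    by (simp add: algebra_simps)
  then have gain: "?D * ((r - \<rho>) * (u $ i * v $ i)) \<le> ?D * ((spec_radius B - \<rho>) * (u \<bullet> v))"
    by (rule mult_left_mono[OF _ less_imp_le[OF D]])
  have "((r - \<rho>) * m\<^sup>2) * (u \<bullet> v) = (r - \<rho>) * (m\<^sup>2 * (u \<bullet> v))"
    by (rule mult.assoc)
  also have "\<dots> \<le> (r - \<rho>) * (?D * (u $ i * v $ i))"
    using weight r by (intro mult_left_mono) simp_all
  also have "\<dots> = ?D * ((r - \<rho>) * (u $ i * v $ i))"
    by (rule mult.left_commute)
  also note gain
  also have "?D * ((spec_radius B - \<rho>) * (u \<bullet> v)) = (?D * (spec_radius B - \<rho>)) * (u \<bullet> v)"
    by (rule mult.assoc[symmetric])
  finally have "((r - \<rho>) * m\<^sup>2) * (u \<bullet> v) \<le> (?D * (spec_radius B - \<rho>)) * (u \<bullet> v)" .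
  then have "(r - \<rho>) * m\<^sup>2 \<le> ?D * (spec_radius B - \<rho>)"
    by (rule mult_right_le_imp_le[OF _ uv])
  then show ?thesis
    using D by (simp add: pos_divide_le_eq mult_ac)
qed

section \<open>Rate of convergence\<close>

lemma compact_entries:
  fixes F :: "'n::finite \<Rightarrow> (real ^ 'n) set"
  assumes "\<And>i. uncertainty_set (F i)"
  shows "compact (entries F)" "entries F \<noteq> {}"
proof -
  have eq: "entries F = (\<Union>i. \<Union>j. (\<lambda>x. x $ j) ` F i)"
    by (auto simp: entries_def)
  show "compact (entries F)"
    unfolding eq using assms
    by (intro compact_UN compact_continuous_image continuous_intros) (auto simp: uncertainty_set_def)
  show "entries F \<noteq> {}"
    unfolding eq using assms by (auto simp: uncertainty_set_def)
qed

lemma pivot_ratio_ge: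
  fixes F :: "'n::finite \<Rightarrow> (real ^ 'n) set"
  assumes "compact (F j)" "0 < v $ j" "b \<in> F j"
  shows "b \<bullet> v \<le> pivot_ratio F v j * v $ j"
proof -
  have "compact ((\<lambda>b. b \<bullet> v) ` F j)"
    using assms by (intro compact_continuous_image continuous_intros)
  then have "bdd_above ((\<lambda>b. b \<bullet> v) ` F j)"
    by (intro bounded_imp_bdd_above compact_imp_bounded)
  then have "b \<bullet> v \<le> (SUP b\<in>F j. b \<bullet> v)"
    using assms(3) by (rule cSUP_upper2) auto
  then show ?thesis
    using assms(2) by (simp add: pivot_ratio_def)
qed

lemma pivot_ratio_eq:
  fixes F :: "'n::finite \<Rightarrow> (real ^ 'n) set"
  assumes "is_maximizer (F i) v b" "0 < v $ i"
  shows "pivot_ratio F v i * v $ i = b \<bullet> v"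
proof -
  have "(SUP b\<in>F i. b \<bullet> v) = b \<bullet> v"
    using assms(1) by (intro cSup_eq_maximum) (auto simp: is_maximizer_def)
  then show ?thesis
    using assms(2) by (simp add: pivot_ratio_def)
qed

text \<open>
  What the greedy and the spectral simplex step have in common. The rate only depends on
  these two features: no row gets worse, and a row of largest pivot ratio becomes optimal.
\<close>

definition pivot_improvement ::
  "('n \<Rightarrow> (real ^ 'n) set) \<Rightarrow> real ^ 'n \<Rightarrow> real ^ 'n ^ 'n \<Rightarrow> real ^ 'n ^ 'n \<Rightarrow> bool" where
  "pivot_improvement F v A B \<longleftrightarrow>
     (\<forall>j. B $ j \<in> F j \<and> A $ j \<bullet> v \<le> B $ j \<bullet> v) \<and>
     (\<exists>i. (\<forall>j. pivot_ratio F v j \<le> pivot_ratio F v i) \<and> is_maximizer (F i) v (B $ i))"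

lemma max_pivot_ratio_exists:
  fixes F :: "'n::finite \<Rightarrow> (real ^ 'n) set"
  obtains i where "\<And>j. pivot_ratio F v j \<le> pivot_ratio F v i"
  using Max_in[of "range (pivot_ratio F v)"] Max_ge[of "range (pivot_ratio F v)"] by fastforce

lemma greedy_step_improves:
  assumes "A \<in> product_family F" "greedy_step F v A B"
  shows "pivot_improvement F v A B"
proof -
  have B: "is_maximizer (F j) v (B $ j)" for j
    using assms(2) unfolding greedy_step_def by metis
  moreover have "A $ j \<in> F j" for j
    using assms(1) by (simp add: product_family_def)
  moreover obtain i where "\<And>j. pivot_ratio F v j \<le> pivot_ratio F v i"
    using max_pivot_ratio_exists by blast
  ultimately show ?thesis
    unfolding pivot_improvement_def by (auto simp: is_maximizer_def)
qed

text \<open>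
  When all rows are already optimal, both methods keep the matrix, so this case is a greedy step.
\<close>

lemma spectral_simplex_step_improves:
  assumes A: "A \<in> product_family F" and step: "spectral_simplex_step F v A B"
  shows "pivot_improvement F v A B"
proof (cases "\<forall>i. is_maximizer (F i) v (A $ i)")
  case True
  then have "greedy_step F v A B"
    using step by (simp add: greedy_step_def spectral_simplex_step_def)
  then show ?thesis
    by (rule greedy_step_improves[OF A])
next
  case False
  then obtain i where i: "\<forall>j. pivot_ratio F v j \<le> pivot_ratio F v i"
      "is_maximizer (F i) v (B $ i)" "\<forall>j. j \<noteq> i \<longrightarrow> B $ j = A $ j"
    using step unfolding spectral_simplex_step_def if_not_P[OF False] by blast
  have "B $ j \<in> F j \<and> A $ j \<bullet> v \<le> B $ j \<bullet> v" for j
    using A i by (cases "j = i") (auto simp: product_family_def is_maximizer_def)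
  with i show ?thesis
    unfolding pivot_improvement_def by blast
qed

text \<open>
  The largest pivot ratio \<open>r\<close> bounds every spectral radius in the family, so the gap to the
  optimum is at most \<open>r - \<rho>\<close>, a definite fraction of which is gained.
\<close>

lemma pivot_improvement_contracts:
  fixes F :: "'n::finite \<Rightarrow> (real ^ 'n) set"
  assumes comp: "\<And>i. compact (F i)"
    and bounds: "\<And>i x j. x \<in> F i \<Longrightarrow> m \<le> x $ j \<and> x $ j \<le> M" and m: "0 < m"
    and A: "A \<in> product_family F" and v: "leading_eigenvector A v"
    and w: "leading_eigenvector B w" and imp: "pivot_improvement F v A B"
  shows "max_spec_radius F - spec_radius B
    \<le> (1 - m\<^sup>2 / (m\<^sup>2 + (real CARD('n) - 1) * M\<^sup>2)) * (max_spec_radius F - spec_radius A)"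
proof -
  let ?p = "m\<^sup>2 / (m\<^sup>2 + (real CARD('n) - 1) * M\<^sup>2)"
  have entry: "m \<le> C $ i $ j" "C $ i $ j \<le> M" "0 < C $ i $ j"
    if "C \<in> product_family F" for C i j
    using bounds[of "C $ i" i j] that m by (auto simp: product_family_def)
  have B: "B \<in> product_family F"
    using imp by (simp add: pivot_improvement_def product_family_def)
  obtain i where i: "\<And>j. pivot_ratio F v j \<le> pivot_ratio F v i" "is_maximizer (F i) v (B $ i)"
    using imp unfolding pivot_improvement_def by blast
  define r where "r = pivot_ratio F v i"
  have vpos: "0 < v $ j" for j
    using leading_eigenvector_pos[OF entry(3)[OF A] v] .
  have eig: "A *v v = spec_radius A *s v"
    using v by (simp add: leading_eigenvector_def)
  have row_le: "b \<bullet> v \<le> r * v $ j" if "b \<in> F j" for b j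
  proof -
    have "b \<bullet> v \<le> pivot_ratio F v j * v $ j"
      using that by (intro pivot_ratio_ge comp vpos)
    also have "\<dots> \<le> r * v $ j"
      unfolding r_def using vpos[of j] i(1) by (intro mult_right_mono) auto
    finally show ?thesis .
  qed
  have "spec_radius C \<le> r" if C: "C \<in> product_family F" for C
    using C row_le
    by (intro spec_radius_le[OF entry(3)[OF C] vpos])
      (auto simp: matrix_vector_mul_component product_family_def)
  moreover have "product_family F \<noteq> {}"
    using A by auto
  ultimately have max_le: "max_spec_radius F \<le> r" and \<rho>: "spec_radius A \<le> r"
    unfolding max_spec_radius_def using A by (auto intro: cSUP_least)
  have D: "0 < m\<^sup>2 + (real CARD('n) - 1) * M\<^sup>2"
    using m by (intro add_pos_nonneg) (auto simp: Suc_le_eq)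
  have "?p * (max_spec_radius F - spec_radius A) \<le> ?p * (r - spec_radius A)"
    using max_le D by (intro mult_left_mono) auto
  also have "\<dots> \<le> spec_radius B - spec_radius A"
  proof (rule spec_radius_gain[OF entry(1)[OF B] entry(2)[OF B] m w vpos])
    show "m * v $ j \<le> M * v $ i" for j
      by (rule positive_eigenvector_ratio[OF entry(1)[OF A] entry(2)[OF A] m vpos eig])
    show "spec_radius A * v $ j \<le> (B *v v) $ j" for j
    proof -
      have "spec_radius A * v $ j = A $ j \<bullet> v"
        using arg_cong[OF eig, of "\<lambda>y. y $ j"] by (simp add: matrix_vector_mul_component)
      also have "\<dots> \<le> B $ j \<bullet> v"
        using imp by (simp add: pivot_improvement_def)
      finally show ?thesis
        by (simp add: matrix_vector_mul_component)
    qed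
    show "r * v $ i \<le> (B *v v) $ i"
      using pivot_ratio_eq[where F = F and i = i, OF i(2) vpos[of i]] by (simp add: r_def matrix_vector_mul_component)
  qed (rule \<rho>)
  finally show ?thesis
    by (simp add: algebra_simps)
qed

lemma linear_rate_of_contraction:
  assumes "0 \<le> q"
    and "\<And>k. k \<ge> 1 \<Longrightarrow> max_spec_radius F - spec_radius (A (k + 1))
           \<le> q * (max_spec_radius F - spec_radius (A k))"
  shows "linear_rate F A q"
  unfolding linear_rate_def
proof (intro allI impI)
  fix k :: nat assume "k \<ge> 1"
  then show "max_spec_radius F - spec_radius (A (k + 1))
             \<le> q ^ k * (max_spec_radius F - spec_radius (A 1))"
  proof (induction k rule: dec_induct)
    case base
    then show ?case using assms(2)[of 1] by simp
  next
    case (step k)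
    have "max_spec_radius F - spec_radius (A (Suc k + 1))
        \<le> q * (max_spec_radius F - spec_radius (A (k + 1)))"
      using assms(2)[of "Suc k"] by simp
    also have "\<dots> \<le> q * (q ^ k * (max_spec_radius F - spec_radius (A 1)))"
      using step.IH assms(1) by (rule mult_left_mono)
    finally show ?case
      by (simp add: mult.assoc)
  qed
qed

text \<open>
  The successor \<open>A (k + 1)\<close> also has a leading eigenvector in the run, namely \<open>v (k + 1)\<close>; this is
  what identifies the eigenvalue of its left Perron vector with its spectral radius.
\<close>

lemma method_run_linear_rate:
  fixes F :: "'n::finite \<Rightarrow> (real ^ 'n) set"
  assumes comp: "\<And>i. compact (F i)"
    and bounds: "\<And>i x j. x \<in> F i \<Longrightarrow> m \<le> x $ j \<and> x $ j \<le> M" and m: "0 < m"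
    and q: "0 \<le> 1 - m\<^sup>2 / (m\<^sup>2 + (real CARD('n) - 1) * M\<^sup>2)"
    and improves: "\<And>v A B. A \<in> product_family F \<Longrightarrow> step F v A B \<Longrightarrow> pivot_improvement F v A B"
    and run: "method_run step F A v"
  shows "linear_rate F A (1 - m\<^sup>2 / (m\<^sup>2 + (real CARD('n) - 1) * M\<^sup>2))"
proof (rule linear_rate_of_contraction[OF q])
  have lead: "leading_eigenvector (A k) (v k)" and next_step: "step F (v k) (A k) (A (k + 1))"
    if "k \<ge> 1" for k
    using run that by (auto simp: method_run_def)
  have mem: "A k \<in> product_family F" if "k \<ge> 1" for k
    using that
  proof (induction k rule: dec_induct)
    case base
    then show ?case using run by (simp add: method_run_def)
  next
    case (step k)
    then show ?case
      using improves[OF step.IH next_step]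
      by (simp add: pivot_improvement_def product_family_def)
  qed
  fix k :: nat assume k: "k \<ge> 1"
  show "max_spec_radius F - spec_radius (A (k + 1))
    \<le> (1 - m\<^sup>2 / (m\<^sup>2 + (real CARD('n) - 1) * M\<^sup>2)) * (max_spec_radius F - spec_radius (A k))"
    by (rule pivot_improvement_contracts[OF comp bounds m mem[OF k] lead[OF k] lead
          improves[OF mem[OF k] next_step[OF k]]]) auto
qed

theorem theorem4:
  fixes F :: "'n::finite \<Rightarrow> (real ^ 'n) set" and m M :: real
  assumes "\<And>i. uncertainty_set (F i)"
    and "\<And>i. strictly_positive (F i)"
    and "m = smallest_entry F"
    and "M = biggest_entry F"
  shows "\<exists>q. 0 \<le> q \<and> q \<le> 1 - m\<^sup>2 / (m\<^sup>2 + (real CARD('n) - 1) * M\<^sup>2) \<and>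
           (\<forall>A v. method_run greedy_step F A v \<longrightarrow> linear_rate F A q) \<and>
           (\<forall>A v. method_run spectral_simplex_step F A v \<longrightarrow> linear_rate F A q)"
proof -
  let ?q = "1 - m\<^sup>2 / (m\<^sup>2 + (real CARD('n) - 1) * M\<^sup>2)"
  have comp: "compact (F i)" for i
    using assms(1) by (simp add: uncertainty_set_def)
  have entries: "compact (entries F)" "entries F \<noteq> {}"
    using compact_entries assms(1) by blast+
  have bdd: "bdd_below (entries F)" "bdd_above (entries F)"
    using entries(1) by (auto intro: bounded_imp_bdd_below bounded_imp_bdd_above compact_imp_bounded)
  have bounds: "m \<le> x $ j \<and> x $ j \<le> M" if "x \<in> F i" for i x j
  proof -
    have "x $ j \<in> entries F"
      using that by (auto simp: entries_def)
    then show ?thesis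
      using bdd by (auto simp: assms smallest_entry_def biggest_entry_def intro: cInf_lower cSup_upper)
  qed
  \<comment> \<open>The infimum is attained by compactness, which makes it positive and not merely non-negative.\<close>
  have "m \<in> entries F"
    unfolding assms smallest_entry_def
    using entries bdd by (intro closed_contains_Inf compact_imp_closed)
  then have m: "0 < m"
    using assms(2) by (auto simp: entries_def strictly_positive_def)
  have "0 \<le> (real CARD('n) - 1) * M\<^sup>2"
    by (simp add: Suc_le_eq)
  then have q: "0 \<le> ?q"
    using m by (simp add: divide_le_eq_1 add_pos_nonneg)
  show ?thesis
  proof (intro exI[of _ ?q] conjI allI impI)
    fix A v assume run: "method_run greedy_step F A v"
    show "linear_rate F A ?q"
      by (rule method_run_linear_rate[OF comp _ m q _ run])
        (erule bounds, rule greedy_step_improves)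
  next
    fix A v assume run: "method_run spectral_simplex_step F A v"
    show "linear_rate F A ?q"
      by (rule method_run_linear_rate[OF comp _ m q _ run])
        (erule bounds, rule spectral_simplex_step_improves)
  qed (use q in simp_all)
qed

end
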